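(* Let $d\ge1$ and $\mathfrak{X}=\bar{\mathbb{R}}^d$, and let $\delta,\sigma,\iota,\alpha:\ell^\infty(\bar{\mathbb{R}}^d)\to\mathbb{R}$ be $\delta(f)=\|f\|_\infty$, $\sigma(f)=\sup f$, $\iota(f)=\inf f$, $\alpha(f)=\sup f-\inf f$. For any $f\in\mathcal{D}(\bar{\mathbb{R}}^d)\setminus\{0\}$, the maps $\delta,\sigma,\iota,\alpha$ are Hadamard directionally differentiable at $f$ tangentially to $\mathcal{D}(\bar{\mathbb{R}}^d)$. For $g\in\mathcal{D}(\bar{\mathbb{R}}^d)$, their derivatives are $$\delta'_f(g)=\max_{\mathbf{v}\in\mathcal{V}}\sup_{M^+_{\mathbf{v}}(|f|)}\big(g_{\mathbf{v}}\cdot\operatorname{sgn}(f_{\mathbf{v}})\big),\qquad \sigma'_f(g)=\max_{\mathbf{v}\in\mathcal{V}}\sup_{M^+_{\mathbf{v}}(f)}g_{\mathbf{v}},$$ $$\iota'_f(g)=\min_{\mathbf{v}\in\mathcal{V}}\inf_{M^-_{\mathbf{v}}(f)}g_{\mathbf{v}},\qquad \alpha'_f(g)=\max_{\mathbf{v}\in\mathcal{V}}\sup_{M^+_{\mathbf{v}}(f)}g_{\mathbf{v}}-\min_{\mathbf{v}\in\mathcal{V}}\inf_{M^-_{\mathbf{v}}(f)}g_{\mathbf{v}},$$ where for $h\in\mathcal{D}(\bar{\mathbb{R}}^d)$, $$M^+_{\mathbf{v}}(h)=\{\mathbf{x}\in\bar{\mathbb{R}}^d:Q_{\mathbf{v}}(\mathbf{x})\ne\emptyset\text{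 and }h_{\mathbf{v}}(\mathbf{x})=\sup h\},\quad M^-_{\mathbf{v}}(h)=\{\mathbf{x}\in\bar{\mathbb{R}}^d:Q_{\mathbf{v}}(\mathbf{x})\ne\emptyset\text{ and }h_{\mathbf{v}}(\mathbf{x})=\inf h\}.$$
   Context: $\bar{\mathbb{R}}=[-\infty,+\infty]$; $\bar{\mathbb{R}}^d$ carries the metric $d_e$ transported from the Euclidean metric on $[0,1]^d$ through a fixed homeomorphism, so it is a compact metric space. $\ell^\infty(\bar{\mathbb{R}}^d)$ is the Banach space of bounded real functions on $\bar{\mathbb{R}}^d$ with the supremum norm; $\operatorname{sgn}$ is the sign function. Suprema (infima) over the empty set are $-\infty$ ($+\infty$). Quadrants: $\mathcal{V}=\{-1,1\}^d$. For $x\in\bar{\mathbb{R}}$, $I_{-1}(x)=[-\infty,x)$ (empty if $x=-\infty$) and $I_{+1}(x)=(x,+\infty]$ (empty if $x=+\infty$). For $\mathbf{v}\in\mathcal{V}$, $\mathbf{x}\in\bar{\mathbb{R}}^d$, $Q_{\mathbf{v}}(\mathbf{x})=I_{v_1}(x_1)\times\cdots\times I_{v_d}(x_d)$. A number $l\in\mathbb{R}$ is the $\mathbf{v}$-limit of $f:\bar{\mathbb{R}}^d\to\mathbb{R}$ at $\mathbf{x}$, denoted $f_{\mathbf{v}}(\mathbf{x})$, if $Q_{\mathbf{v}}(\mathbf{x})\neq\emptyset$ and $f(\mathbf{x}_n)\to l$ for every sequence $\{\mathbf{x}_n\}\subset Q_{\mathbf{v}}(\mathbf{x})$ with $\mathbf{x}_n\to\mathbf{x}$.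 Let $\mathbf{v}_{\mathbf{x}}\in\mathcal{V}$ have $i$-th coordinate $+1$ if $x_i<+\infty$ and $-1$ if $x_i=+\infty$. $f$ is continuous from above if for every $\mathbf{x}\in\bar{\mathbb{R}}^d$ the limit $f_{\mathbf{v}_{\mathbf{x}}}(\mathbf{x})$ exists and equals $f(\mathbf{x})$. The Skorohod space $\mathcal{D}(\bar{\mathbb{R}}^d)$ is the collection of all continuous from above functions $f:\bar{\mathbb{R}}^d\to\mathbb{R}$ such that $f_{\mathbf{v}}(\mathbf{x})$ exists for every $\mathbf{v}\in\mathcal{V}$ and $\mathbf{x}\in\bar{\mathbb{R}}^d$ with $Q_{\mathbf{v}}(\mathbf{x})\ne\emptyset$; it is contained in $\ell^\infty(\bar{\mathbb{R}}^d)$. Hadamard directional differentiability: let $\mathcal{D},\mathcal{E}$ be real Banach spaces. A map $\phi:\mathcal{D}\to\mathcal{E}$ is Hadamard directionally differentiable at $\theta\in\mathcal{D}$ tangentially to a set $\mathcal{D}_0\subset\mathcal{D}$ if there is a map $\phi'_\theta:\mathcal{D}_0\to\mathcal{E}$ (the derivative, not required to be linear) such that $\big\|\frac{\phi(\theta+t_nh_n)-\phi(\theta)}{t_n}-\phi'_\theta(h)\big\|_{\mathcal{E}}\to0$ for all $h\in\mathcal{D}_0$ and all sequences $\{t_n\}\subset\mathbb{R}$, $\{h_n\}\subset\mathcal{D}$ with $t_n\downarrow0$ and $\|h_n-h\|_{\mathcal{D}}\to0$. *)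

theory Defs
  imports "HOL-Analysis.Analysis" "HOL-Probability.Discrete_Topology"
begin

section \<open>Quadrants and directional limits on the extended Euclidean space\<close>

text \<open>
  The \<open>d\<close>-fold product of the extended real line is \<^typ>\<open>ereal ^ 'd\<close> with \<open>d = CARD('d)\<close>. Its
  topology in the library is the product of the order topologies. This is the topology of the
  metric transported from the unit cube, and only convergence of sequences is used below.
\<close>

definition sign_vectors :: "(int ^ 'd) set" where
  "sign_vectors = {v. \<forall>i. v $ i = -1 \<or> v $ i = 1}"

definition half_line :: "int \<Rightarrow> ereal \<Rightarrow> ereal set" where
  "half_line s x = (if s = -1 then {..<x} else {x<..})"

definition quadrant :: "int ^ 'd \<Rightarrow> ereal ^ 'd \<Rightarrow> (ereal ^ 'd) set" where
  "quadrant v x = {y. \<forall>i. y $ i \<in> half_line (v $ i) (x $ i)}"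

definition is_vlim :: "int ^ 'd \<Rightarrow> (ereal ^ 'd \<Rightarrow> real) \<Rightarrow> ereal ^ 'd \<Rightarrow> real \<Rightarrow> bool" where
  "is_vlim v f x l \<longleftrightarrow> quadrant v x \<noteq> {} \<and>
     (\<forall>X. (\<forall>n. X n \<in> quadrant v x) \<longrightarrow> X \<longlonglongrightarrow> x \<longrightarrow> (\<lambda>n. f (X n)) \<longlonglongrightarrow> l)"

text \<open>Meaningful only where the limit exists; it is then unique, see \<open>vlim_eq\<close> below.\<close>

definition vlim :: "int ^ 'd \<Rightarrow> (ereal ^ 'd \<Rightarrow> real) \<Rightarrow> ereal ^ 'd \<Rightarrow> real" where
  "vlim v f x = (THE l. is_vlim v f x l)"

definition above_vector :: "ereal ^ 'd \<Rightarrow> int ^ 'd" where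
  "above_vector x = (\<chi> i. if x $ i < \<infinity> then 1 else -1)"

definition continuous_from_above :: "(ereal ^ 'd \<Rightarrow> real) \<Rightarrow> bool" where
  "continuous_from_above f \<longleftrightarrow> (\<forall>x. is_vlim (above_vector x) f x (f x))"

definition skorohod_fun :: "(ereal ^ 'd \<Rightarrow> real) \<Rightarrow> bool" where
  "skorohod_fun f \<longleftrightarrow> continuous_from_above f \<and>
     (\<forall>v\<in>sign_vectors. \<forall>x. quadrant v x \<noteq> {} \<longrightarrow> (\<exists>l. is_vlim v f x l))"

section \<open>Bounded functions with the supremum norm\<close>

text \<open>
  On a discrete space every function is continuous, so the library's Banach space of bounded
  continuous functions on \<^typ>\<open>'a discrete\<close> is the space of all bounded functions on \<^typ>\<open>'a\<close>.
\<close>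

instance bcontfun :: (metric_space, banach) banach ..

type_synonym 'a linf = "'a discrete \<Rightarrow>\<^sub>C real"

definition val :: "'a linf \<Rightarrow> 'a \<Rightarrow> real" where
  "val f x = apply_bcontfun f (discrete x)"

text \<open>By \<open>skorohod_fun_in_linf\<close> below, no Skorohod function is lost by restricting to bounded ones.\<close>

definition skorohod :: "(ereal ^ 'd) linf set" where
  "skorohod = {f. skorohod_fun (val f)}"

definition delta :: "'a linf \<Rightarrow> real" where
  "delta f = norm f"

definition sigma :: "'a linf \<Rightarrow> real" where
  "sigma f = (SUP x. val f x)"

definition iota :: "'a linf \<Rightarrow> real" where
  "iota f = (INF x. val f x)"

definition alpha :: "'a linf \<Rightarrow> real" where
  "alpha f = (SUP x. val f x) - (INF x. val f x)"

definition Mplus :: "int ^ 'd \<Rightarrow> (ereal ^ 'd \<Rightarrow> real) \<Rightarrow> (ereal ^ 'd) set" where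
  "Mplus v h = {x. quadrant v x \<noteq> {} \<and> vlim v h x = (SUP y. h y)}"

definition Mminus :: "int ^ 'd \<Rightarrow> (ereal ^ 'd \<Rightarrow> real) \<Rightarrow> (ereal ^ 'd) set" where
  "Mminus v h = {x. quadrant v x \<noteq> {} \<and> vlim v h x = (INF y. h y)}"

section \<open>Hadamard directional differentiability\<close>

text \<open>
  \<open>\<phi>'\<close> is the derivative of \<open>\<phi>\<close> at \<open>\<theta>\<close> tangentially to \<open>D0\<close>; its values outside \<open>D0\<close> are
  irrelevant. The step sizes are positive and tend to \<open>0\<close>, not necessarily monotonically.
\<close>

definition has_hadamard_dir_derivative ::
    "('a::banach \<Rightarrow> 'b::banach) \<Rightarrow> ('a \<Rightarrow> 'b) \<Rightarrow> 'a \<Rightarrow> 'a set \<Rightarrow> bool" where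
  "has_hadamard_dir_derivative \<phi> \<phi>' \<theta> D0 \<longleftrightarrow>
     (\<forall>h\<in>D0. \<forall>(t :: nat \<Rightarrow> real) (H :: nat \<Rightarrow> 'a).
        (\<forall>n. t n > 0) \<longrightarrow> t \<longlonglongrightarrow> 0 \<longrightarrow> (\<lambda>n. norm (H n - h)) \<longlonglongrightarrow> 0 \<longrightarrow>
        (\<lambda>n. norm ((\<phi> (\<theta> + t n *\<^sub>R H n) - \<phi> \<theta>) /\<^sub>R t n - \<phi>' h)) \<longlonglongrightarrow> 0)"

section \<open>Well-definedness\<close>

lemma finite_sign_vectors: "finite (sign_vectors :: (int ^ 'd) set)"
proof -
  have "(sign_vectors :: (int ^ 'd) set) \<subseteq> vec_lambda ` (UNIV \<rightarrow>\<^sub>E {-1, 1 :: int})"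
  proof
    fix v :: "int ^ 'd" assume "v \<in> sign_vectors"
    then have "vec_nth v \<in> UNIV \<rightarrow>\<^sub>E {-1, 1}"
      by (auto simp: sign_vectors_def)
    then show "v \<in> vec_lambda ` (UNIV \<rightarrow>\<^sub>E {-1, 1 :: int})"
      by (metis image_eqI vec_nth_inverse)
  qed
  then show ?thesis
    by (rule finite_subset) (intro finite_imageI finite_PiE; simp)
qed

lemma norm_linf: "norm (f :: 'a linf) = (SUP x. \<bar>val f x\<bar>)"
proof -
  have "range (\<lambda>x. \<bar>apply_bcontfun f x\<bar>) = range (\<lambda>x. \<bar>val f x\<bar>)"
  proof (intro equalityI subsetI)
    fix y assume "y \<in> range (\<lambda>x. \<bar>apply_bcontfun f x\<bar>)"
    then obtain x where "y = \<bar>apply_bcontfun f x\<bar>" by blast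
    then have "y = \<bar>val f (of_discrete x)\<bar>" by (simp add: val_def of_discrete_inverse)
    then show "y \<in> range (\<lambda>x. \<bar>val f x\<bar>)" by blast
  qed (auto simp: val_def)
  then show ?thesis
    by (simp add: norm_bcontfun_def dist_bcontfun_def)
qed

lemma linf_of_bounded:
  assumes "bounded (range f)"
  shows "\<exists>F :: 'a linf. val F = f"
proof -
  have "(f \<circ> of_discrete) \<in> bcontfun"
    using assms unfolding bcontfun_def
    by (auto simp: continuous_on_open_vimage open_discrete intro: bounded_subset)
  then show ?thesis
    by (intro exI[of _ "Bcontfun (f \<circ> of_discrete)"])
       (auto simp: val_def Bcontfun_inverse discrete_inverse)
qed

lemma half_line_seq:
  assumes "half_line s x \<noteq> {}"
  shows "\<exists>u :: nat \<Rightarrow> ereal. (\<forall>n. u n \<in> half_line s x) \<and> u \<longlonglongrightarrow> x"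
proof (cases "s = -1")
  case True
  then obtain y where "y < x" using assms by (auto simp: half_line_def)
  from approx_from_below_dense_linorder[OF this] True show ?thesis
    by (auto simp: half_line_def)
next
  case False
  then obtain y where "x < y" using assms by (auto simp: half_line_def)
  from approx_from_above_dense_linorder[OF this] False show ?thesis
    by (auto simp: half_line_def)
qed

lemma quadrant_seq:
  fixes x :: "ereal ^ 'd"
  assumes "quadrant v x \<noteq> {}"
  shows "\<exists>X. (\<forall>n. X n \<in> quadrant v x) \<and> X \<longlonglongrightarrow> x"
proof -
  have "\<forall>i. \<exists>u :: nat \<Rightarrow> ereal. (\<forall>n. u n \<in> half_line (v $ i) (x $ i)) \<and> u \<longlonglongrightarrow> x $ i"
  proof
    fix i
    have "half_line (v $ i) (x $ i) \<noteq> {}"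
      using assms by (auto simp: quadrant_def)
    then show "\<exists>u :: nat \<Rightarrow> ereal. (\<forall>n. u n \<in> half_line (v $ i) (x $ i)) \<and> u \<longlonglongrightarrow> x $ i"
      by (rule half_line_seq)
  qed
  from choice[OF this] obtain u :: "'d \<Rightarrow> nat \<Rightarrow> ereal"
    where u: "\<And>i n. u i n \<in> half_line (v $ i) (x $ i)" "\<And>i. u i \<longlonglongrightarrow> x $ i"
    by auto
  have "(\<lambda>n. \<chi> i. u i n) \<longlonglongrightarrow> x"
    by (rule vec_tendstoI) (simp add: u)
  then show ?thesis
    using u(1) by (intro exI[of _ "\<lambda>n. \<chi> i. u i n"]) (simp add: quadrant_def)
qed

lemma vlim_eq:
  assumes "is_vlim v f x l"
  shows "vlim v f x = l"
  unfolding vlim_def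
proof (rule the_equality)
  fix l' assume "is_vlim v f x l'"
  then show "l' = l"
    using assms quadrant_seq[of v x] LIMSEQ_unique unfolding is_vlim_def by metis
qed (fact assms)

lemma ereal_subseq:
  fixes u :: "nat \<Rightarrow> ereal"
  shows "\<exists>r z. strict_mono r \<and> (\<lambda>n. u (r n)) \<longlonglongrightarrow> z \<and>
    ((\<forall>n. u (r n) < z) \<or> (\<forall>n. u (r n) = z) \<or> (\<forall>n. u (r n) > z))"
proof -
  have "seq_compact (UNIV :: ereal set)"
    using compact_UNIV compact_imp_seq_compact by blast
  then obtain z r where r: "strict_mono r" "(u \<circ> r) \<longlonglongrightarrow> z"
    unfolding seq_compact_def by (metis UNIV_I)
  have "\<exists>s :: nat \<Rightarrow> nat. strict_mono s \<and> ((\<forall>n. u (r (s n)) < z) \<or> (\<forall>n. u (r (s n)) = z) \<or> (\<forall>n. u (r (s n)) > z))"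
  proof -
    let ?A = "{n. u (r n) < z}" and ?B = "{n. u (r n) = z}" and ?C = "{n. u (r n) > z}"
    have "?A \<union> ?B \<union> ?C = UNIV" by auto
    then have "infinite ?A \<or> infinite ?B \<or> infinite ?C"
      by (metis finite_UnI infinite_UNIV_nat)
    then show ?thesis
    proof (elim disjE)
      assume "infinite ?A"
      from infinite_enumerate[OF this] show ?thesis by auto
    next
      assume "infinite ?B"
      from infinite_enumerate[OF this] show ?thesis by auto
    next
      assume "infinite ?C"
      from infinite_enumerate[OF this] show ?thesis by auto
    qed
  qed
  then obtain s :: "nat \<Rightarrow> nat" where s: "strict_mono s"
    "(\<forall>n. u (r (s n)) < z) \<or> (\<forall>n. u (r (s n)) = z) \<or> (\<forall>n. u (r (s n)) > z)" by blast
  have "((u \<circ> r) \<circ> s) \<longlonglongrightarrow> z" using r(2) s(1) by (rule LIMSEQ_subseq_LIMSEQ)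
  then show ?thesis
    using strict_mono_o[OF r(1) s(1)] s(2)
    by (intro exI[of _ "r \<circ> s"] exI[of _ z]) (simp add: o_def)
qed

lemma ereal_vec_subseq:
  fixes X :: "nat \<Rightarrow> ereal ^ 'd"
  shows "\<exists>r z. strict_mono r \<and> (\<forall>i. (\<lambda>n. X (r n) $ i) \<longlonglongrightarrow> z $ i \<and>
    ((\<forall>n. X (r n) $ i < z $ i) \<or> (\<forall>n. X (r n) $ i = z $ i) \<or> (\<forall>n. X (r n) $ i > z $ i)))"
proof -
  have "\<exists>r z. strict_mono (r :: nat \<Rightarrow> nat) \<and> (\<forall>i\<in>A. (\<lambda>n. X (r n) $ i) \<longlonglongrightarrow> z i \<and>
    ((\<forall>n. X (r n) $ i < z i) \<or> (\<forall>n. X (r n) $ i = z i) \<or> (\<forall>n. X (r n) $ i > z i)))"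
    if "finite A" for A :: "'d set"
    using that
  proof (induction A)
    case empty
    then show ?case using strict_mono_id by auto
  next
    case (insert a A)
    then obtain r :: "nat \<Rightarrow> nat" and z where r: "strict_mono r"
      "\<And>i. i \<in> A \<Longrightarrow> (\<lambda>n. X (r n) $ i) \<longlonglongrightarrow> z i"
      "\<And>i. i \<in> A \<Longrightarrow> (\<forall>n. X (r n) $ i < z i) \<or> (\<forall>n. X (r n) $ i = z i) \<or> (\<forall>n. X (r n) $ i > z i)"
      by metis
    obtain s w where s: "strict_mono s" "(\<lambda>n. X (r (s n)) $ a) \<longlonglongrightarrow> w"
      "(\<forall>n. X (r (s n)) $ a < w) \<or> (\<forall>n. X (r (s n)) $ a = w) \<or> (\<forall>n. X (r (s n)) $ a > w)"
      using ereal_subseq[of "\<lambda>n. X (r n) $ a"] by blast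
    have lim: "(\<lambda>n. X (r (s n)) $ i) \<longlonglongrightarrow> z i" if "i \<in> A" for i
      using LIMSEQ_subseq_LIMSEQ[OF r(2)[OF that] s(1)] by (simp add: o_def)
    have tri: "(\<forall>n. X (r (s n)) $ i < z i) \<or> (\<forall>n. X (r (s n)) $ i = z i) \<or> (\<forall>n. X (r (s n)) $ i > z i)"
      if "i \<in> A" for i
      using r(3)[OF that] by blast
    show ?case
    proof (intro exI[of _ "\<lambda>n. r (s n)"] exI[of _ "z(a := w)"] conjI ballI)
      show "strict_mono (\<lambda>n. r (s n))"
        using strict_mono_o[OF r(1) s(1)] by (simp add: o_def)
    next
      fix i assume i: "i \<in> insert a A"
      show "(\<lambda>n. X (r (s n)) $ i) \<longlonglongrightarrow> (z(a := w)) i"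
        using i s(2) lim by (cases "i = a") auto
      show "(\<forall>n. X (r (s n)) $ i < (z(a := w)) i) \<or> (\<forall>n. X (r (s n)) $ i = (z(a := w)) i)
          \<or> (\<forall>n. X (r (s n)) $ i > (z(a := w)) i)"
        using i s(3) tri by (cases "i = a") auto
    qed
  qed
  from this[OF finite[of UNIV]] obtain r :: "nat \<Rightarrow> nat" and z where "strict_mono r"
    "\<forall>i. (\<lambda>n. X (r n) $ i) \<longlonglongrightarrow> z i \<and>
    ((\<forall>n. X (r n) $ i < z i) \<or> (\<forall>n. X (r n) $ i = z i) \<or> (\<forall>n. X (r n) $ i > z i))"
    by auto
  then show ?thesis
    by (intro exI[of _ r] exI[of _ "\<chi> i. z i"]) simp
qed

lemma skorohod_fun_bounded:
  fixes f :: "ereal ^ 'd \<Rightarrow> real"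
  assumes f: "skorohod_fun f"
  shows "bounded (range f)"
proof (rule ccontr)
  assume "\<not> bounded (range f)"
  then have "\<forall>n :: nat. \<exists>x. \<bar>f x\<bar> > real n"
    by (auto simp: bounded_iff not_le)
  then obtain X where X: "\<And>n :: nat. \<bar>f (X n)\<bar> > real n" by metis
  obtain r z where r: "strict_mono (r :: nat \<Rightarrow> nat)" "\<And>i. (\<lambda>n. X (r n) $ i) \<longlonglongrightarrow> z $ i"
    "\<And>i. (\<forall>n. X (r n) $ i < z $ i) \<or> (\<forall>n. X (r n) $ i = z $ i) \<or> (\<forall>n. X (r n) $ i > z $ i)"
    using ereal_vec_subseq[of X] by metis
  define W where "W = (\<lambda>n. X (r n))"
  define v :: "int ^ 'd" where "v = (\<chi> i. if W 0 $ i < z $ i then -1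
      else if W 0 $ i = z $ i then above_vector z $ i else 1)"
  have v: "v \<in> sign_vectors" by (auto simp: v_def sign_vectors_def above_vector_def)
  have "\<exists>A. \<forall>n. open (A n) \<and> z $ i \<in> A n \<and> (\<forall>S. open S \<longrightarrow> z $ i \<in> S \<longrightarrow> eventually (\<lambda>n. A n \<subseteq> S) sequentially)" for i
    by (rule countable_basis_at_decseq[of "z $ i"]) metis
  then obtain A where A: "\<And>i n :: nat. open (A i n)" "\<And>i n. z $ i \<in> A i n"
    "\<And>i S. open S \<Longrightarrow> z $ i \<in> S \<Longrightarrow> eventually (\<lambda>n. A i n \<subseteq> S) sequentially"
    by metis
  have "\<exists>y. y \<in> quadrant v z \<and> \<bar>f y - f (W n)\<bar> < 1 \<and> (\<forall>i. \<forall>m\<le>n. W n $ i \<in> A i m \<longrightarrow> y $ i \<in> A i m)" for n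
  proof -
    have ca: "is_vlim (above_vector (W n)) f (W n) (f (W n))"
      using f by (simp add: skorohod_fun_def continuous_from_above_def)
    then obtain Y where Y: "\<And>k. Y k \<in> quadrant (above_vector (W n)) (W n)" "Y \<longlonglongrightarrow> W n"
      using quadrant_seq unfolding is_vlim_def by metis
    with ca have "(\<lambda>k. f (Y k)) \<longlonglongrightarrow> f (W n)" by (auto simp: is_vlim_def)
    then have e1: "eventually (\<lambda>k. \<bar>f (Y k) - f (W n)\<bar> < 1) sequentially"
      using tendstoD[of _ _ _ 1] by (fastforce simp: dist_real_def)
    have Yi: "(\<lambda>k. Y k $ i) \<longlonglongrightarrow> W n $ i" for i
      using Y(2) by (rule tendsto_vec_nth)
    have e2: "eventually (\<lambda>k. \<forall>i. \<forall>m\<in>{..n}. W n $ i \<in> A i m \<longrightarrow> Y k $ i \<in> A i m) sequentially"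
      using topological_tendstoD[OF Yi A(1)]
      by (intro eventually_all_finite eventually_ball_finite ballI) (auto simp: eventually_mono)
    have "eventually (\<lambda>k. Y k $ i \<in> half_line (v $ i) (z $ i)) sequentially" for i
    proof -
      consider "\<forall>n. W n $ i < z $ i" | "\<forall>n. W n $ i = z $ i" | "\<forall>n. W n $ i > z $ i"
        using r(3)[of i] by (auto simp: W_def)
      then show ?thesis
      proof cases
        case 1
        then have "eventually (\<lambda>k. Y k $ i < z $ i) sequentially"
          using order_tendstoD(2)[OF Yi] by blast
        then show ?thesis using 1 by (simp add: v_def half_line_def)
      next
        case 2
        then have "v $ i = above_vector (W n) $ i" by (simp add: v_def above_vector_def)
        then have "Y k $ i \<in> half_line (v $ i) (z $ i)" for k
          using 2[THEN spec, of n] Y(1)[of k] unfolding quadrant_def mem_Collect_eq by metis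
        then show ?thesis by simp
      next
        case 3
        then have "eventually (\<lambda>k. Y k $ i > z $ i) sequentially"
          using order_tendstoD(1)[OF Yi] by blast
        moreover have "v $ i = 1" using 3[THEN spec, of 0] by (auto simp: v_def)
        ultimately show ?thesis by (simp add: half_line_def)
      qed
    qed
    then have "eventually (\<lambda>k. Y k \<in> quadrant v z) sequentially"
      unfolding quadrant_def by (simp add: eventually_all_finite)
    with e1 e2 have "eventually (\<lambda>k. Y k \<in> quadrant v z \<and> \<bar>f (Y k) - f (W n)\<bar> < 1 \<and>
        (\<forall>i. \<forall>m\<in>{..n}. W n $ i \<in> A i m \<longrightarrow> Y k $ i \<in> A i m)) sequentially"
      by (simp add: eventually_conj)
    then obtain k where "Y k \<in> quadrant v z \<and> \<bar>f (Y k) - f (W n)\<bar> < 1 \<and>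
        (\<forall>i. \<forall>m\<in>{..n}. W n $ i \<in> A i m \<longrightarrow> Y k $ i \<in> A i m)"
      using eventually_happens'[OF sequentially_bot] by blast
    then show ?thesis by auto
  qed
  then obtain y where y: "\<And>n. y n \<in> quadrant v z" "\<And>n. \<bar>f (y n) - f (W n)\<bar> < 1"
    "\<And>n i m. m \<le> n \<Longrightarrow> W n $ i \<in> A i m \<Longrightarrow> y n $ i \<in> A i m"
    by metis
  have "(\<lambda>n. y n $ i) \<longlonglongrightarrow> z $ i" for i
  proof (rule topological_tendstoI)
    fix S assume S: "open S" "z $ i \<in> S"
    obtain m where m: "A i m \<subseteq> S"
      using eventually_happens'[OF sequentially_bot A(3)[OF S]] ..
    have "eventually (\<lambda>n. W n $ i \<in> A i m) sequentially"
      using topological_tendstoD[OF r(2) A(1) A(2)] by (simp add: W_def)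
    then show "eventually (\<lambda>n. y n $ i \<in> S) sequentially"
      using eventually_ge_at_top[of m] by eventually_elim (use y(3) m in blast)
  qed
  then have "y \<longlonglongrightarrow> z" by (rule vec_tendstoI)
  moreover obtain l where "is_vlim v f z l"
    using f v y(1) unfolding skorohod_fun_def by blast
  ultimately have "(\<lambda>n. f (y n)) \<longlonglongrightarrow> l" using y(1) by (auto simp: is_vlim_def)
  then have "Bseq (\<lambda>n. f (y n))" by (rule convergent_imp_Bseq[OF convergentI])
  then obtain K where K: "\<And>n. \<bar>f (y n)\<bar> \<le> K" by (auto simp: Bseq_def)
  obtain n :: nat where "K + 1 < real n" using reals_Archimedean2 by blast
  also have "real n \<le> real (r n)" using r(1) by (simp add: seq_suble)
  also have "\<dots> < \<bar>f (W n)\<bar>" using X by (simp add: W_def)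
  finally show False using K[of n] y(2)[of n] by linarith
qed

lemma skorohod_fun_in_linf:
  assumes "skorohod_fun f"
  shows "\<exists>F\<in>skorohod. val F = f"
  using linf_of_bounded[OF skorohod_fun_bounded[OF assms]] assms by (auto simp: skorohod_def)

end

theory Submission
  imports Defs
begin

text \<open>
  The increments of \<open>sup\<close> at \<open>F\<close> in direction \<open>G\<close> are governed by the values of \<open>G\<close> where \<open>F\<close> is
  nearly maximal: the derivative is the limit of \<open>sup {G x | F x > sup F - \<eta>}\<close> as \<open>\<eta>\<close> tends
  to \<open>0\<close>, that is, the largest cluster value of \<open>G\<close> along maximizing sequences of \<open>F\<close>. By compactness,
  every sequence has a subsequence along which all Skorohod functions converge to their \<open>v\<close>-limits
  at one common point, for one common \<open>v\<close>, so these cluster values are the \<open>v\<close>-limits of \<open>G\<close> at the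
  points where the \<open>v\<close>-limit of \<open>F\<close> is \<open>sup F\<close>. The norm is the supremum of \<open>\<bar>f\<bar>\<close>: since \<open>f \<noteq> 0\<close>, the
  function \<open>f\<close> is bounded away from \<open>0\<close> where \<open>\<bar>f\<bar>\<close> is nearly maximal, and there
  \<open>\<bar>f + t g\<bar> = \<bar>f\<bar> + t g sgn f\<close> for small \<open>t\<close>.
\<close>

section \<open>Perturbation of suprema\<close>

text \<open>Because \<open>H\<close> is uniformly bounded, points where \<open>F\<close> is not
  nearly maximal cannot compete for the perturbed supremum once \<open>t n\<close> is small.
  Convergence of \<open>H\<close> to \<open>G\<close> is therefore demanded only where
  \<open>F\<close> exceeds its supremum minus \<open>\<eta>0\<close>; difference quotients of the
  absolute value will be controlled only there.\<close>

lemma sup_perturbation_tendsto: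
  fixes F G :: "'a \<Rightarrow> real"
  assumes F: "bdd_above (range F)"
    and upper: "\<And>e. 0 < e \<Longrightarrow> \<exists>\<eta>>0. \<forall>x. F x > (SUP y. F y) - \<eta> \<longrightarrow> G x < S + e"
    and lower: "\<And>e \<eta>. 0 < e \<Longrightarrow> 0 < \<eta> \<Longrightarrow> \<exists>x. F x > (SUP y. F y) - \<eta> \<and> G x > S - e"
    and t: "\<And>n. t n > 0" "t \<longlonglongrightarrow> 0"
    and H: "\<And>n x. \<bar>H n x\<bar> \<le> C"
    and \<eta>0: "0 < \<eta>0"
    and conv: "\<And>e. 0 < e \<Longrightarrow>
      \<forall>\<^sub>F n in sequentially. \<forall>x. F x > (SUP y. F y) - \<eta>0 \<longrightarrow> \<bar>H n x - G x\<bar> < e"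
  shows "(\<lambda>n. ((SUP x. F x + t n * H n x) - (SUP x. F x)) / t n) \<longlonglongrightarrow> S"
proof (rule tendstoI)
  fix e :: real assume e: "0 < e"
  define M where "M = (SUP y. F y)"
  have FM: "F x \<le> M" for x
    unfolding M_def by (rule cSUP_upper[OF _ F]) simp
  obtain \<eta> where \<eta>: "0 < \<eta>" "\<And>x. F x > M - \<eta> \<Longrightarrow> G x < S + e / 3"
    using upper[of "e / 3"] e unfolding M_def by auto
  define \<eta>' where "\<eta>' = min \<eta> \<eta>0"
  have \<eta>': "0 < \<eta>'" using \<eta>(1) \<eta>0 by (simp add: \<eta>'_def)
  \<comment> \<open>Where \<open>F x \<le> M - \<eta>'\<close>, the perturbed value is at most
    \<open>M - \<eta>' + t n * C\<close>, which lies below \<open>M + t n * S\<close> once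
    \<open>t n * (C - S) < \<eta>'\<close>.\<close>
  have "(\<lambda>n. t n * (C - S)) \<longlonglongrightarrow> 0 * (C - S)"
    by (intro tendsto_intros t)
  then have "\<forall>\<^sub>F n in sequentially. t n * (C - S) < \<eta>'"
    using order_tendstoD(2) \<eta>' by fastforce
  moreover have "\<forall>\<^sub>F n in sequentially. \<forall>x. F x > M - \<eta>0 \<longrightarrow> \<bar>H n x - G x\<bar> < e / 3"
    using conv[of "e / 3"] e unfolding M_def by simp
  ultimately show "\<forall>\<^sub>F n in sequentially.
      dist (((SUP x. F x + t n * H n x) - (SUP x. F x)) / t n) S < e"
  proof eventually_elim
    case (elim n)
    have tn: "t n > 0" by (rule t)
    have le: "F x + t n * H n x \<le> M + t n * (S + 2 * e / 3)" for x
    proof (cases "F x > M - \<eta>'")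
      case True
      then have "G x < S + e / 3" "\<bar>H n x - G x\<bar> < e / 3"
        using \<eta>(2) elim(2) by (auto simp: \<eta>'_def)
      then have "H n x \<le> S + 2 * e / 3" by linarith
      then have "t n * H n x \<le> t n * (S + 2 * e / 3)" using tn by simp
      then show ?thesis using FM[of x] by linarith
    next
      case False
      have "H n x \<le> C" using H[of n x] by linarith
      then have "t n * H n x \<le> t n * C" using tn by simp
      moreover have "0 \<le> t n * (2 * e / 3)" using tn e by simp
      ultimately show ?thesis using False elim(1) by (simp add: algebra_simps)
    qed
    then have up: "(SUP x. F x + t n * H n x) \<le> M + t n * (S + 2 * e / 3)"
      by (intro cSUP_least) auto
    have bdd: "bdd_above (range (\<lambda>x. F x + t n * H n x))"
      using le by (intro bdd_aboveI) auto
    \<comment> \<open>Here \<open>n\<close> is fixed and only \<open>d\<close> tends to 0: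
      evaluating at a point within \<open>d\<close> of the supremum where \<open>G\<close> exceeds
      \<open>S - e / 3\<close> costs no more than \<open>d\<close>.\<close>
    have lo: "M + t n * (S - 2 * e / 3) \<le> (SUP x. F x + t n * H n x)"
    proof (rule field_le_epsilon)
      fix d :: real assume d: "0 < d"
      obtain x where x: "F x > M - min d \<eta>0" "G x > S - e / 3"
        using lower[of "e / 3" "min d \<eta>0"] e d \<eta>0 unfolding M_def by auto
      then have "\<bar>H n x - G x\<bar> < e / 3" using elim(2) by auto
      then have "S - 2 * e / 3 \<le> H n x" using x(2) by linarith
      then have "t n * (S - 2 * e / 3) \<le> t n * H n x" using tn by simp
      then have "M + t n * (S - 2 * e / 3) - d \<le> F x + t n * H n x"
        using x(1) by linarith
      also have "\<dots> \<le> (SUP x. F x + t n * H n x)"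
        by (rule cSUP_upper[OF _ bdd]) simp
      finally show "M + t n * (S - 2 * e / 3) \<le> (SUP x. F x + t n * H n x) + d" by linarith
    qed
    have "((SUP x. F x + t n * H n x) - M) / t n \<le> S + 2 * e / 3"
      using up tn by (simp add: pos_divide_le_eq mult.commute)
    moreover have "S - 2 * e / 3 \<le> ((SUP x. F x + t n * H n x) - M) / t n"
      using lo tn by (simp add: pos_le_divide_eq mult.commute)
    ultimately show ?case
      using e unfolding dist_real_def M_def[symmetric] by linarith
  qed
qed

text \<open>
  \<open>k\<close> lists the cluster values of \<open>G\<close> along maximizing sequences of \<open>F\<close>.
\<close>

lemma sup_perturbation_cluster_values:
  fixes F G :: "'a \<Rightarrow> real" and k :: "'j \<Rightarrow> real"
  assumes F: "bdd_above (range F)" and G: "\<And>x. \<bar>G x\<bar> \<le> B"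
    and cluster: "\<forall>X :: nat \<Rightarrow> 'a. (\<lambda>n. F (X n)) \<longlonglongrightarrow> (SUP x. F x) \<longrightarrow>
      (\<exists>j\<in>J. \<exists>r :: nat \<Rightarrow> nat. (\<lambda>n. G (X (r n))) \<longlonglongrightarrow> k j)"
    and attained: "\<forall>j\<in>J.
      \<exists>X :: nat \<Rightarrow> 'a. (\<lambda>n. F (X n)) \<longlonglongrightarrow> (SUP x. F x) \<and> (\<lambda>n. G (X n)) \<longlonglongrightarrow> k j"
  shows "\<exists>S. ereal S = (SUP j\<in>J. ereal (k j)) \<and>
    (\<forall>e>0. \<exists>\<eta>>0. \<forall>x. F x > (SUP y. F y) - \<eta> \<longrightarrow> G x < S + e) \<and>
    (\<forall>e>0. \<forall>\<eta>>0. \<exists>x. F x > (SUP y. F y) - \<eta> \<and> G x > S - e)"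
proof -
  define M where "M = (SUP y. F y)"
  have FM: "F x \<le> M" for x
    unfolding M_def by (rule cSUP_upper[OF _ F]) simp
  have maximizing: "(\<lambda>n. F (X n)) \<longlonglongrightarrow> M" if "\<And>n. F (X n) > M - 1 / real (Suc n)" for X
  proof (rule tendsto_sandwich)
    show "(\<lambda>n. M - 1 / real (Suc n)) \<longlonglongrightarrow> M"
      using tendsto_diff[OF tendsto_const LIMSEQ_inverse_real_of_nat, of M]
      by (simp add: inverse_eq_divide)
    show "(\<lambda>n. M) \<longlonglongrightarrow> M" by simp
  qed (use that FM in \<open>auto intro!: always_eventually less_imp_le\<close>)
  \<comment> \<open>A maximizing sequence exists, so \<open>cluster\<close> provides an index in
    \<open>J\<close>. With the bound \<open>kB\<close> this makes the real supremum \<open>S\<close>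
    genuine and equal to the extended-real one.\<close>
  have "\<exists>x. F x > M - 1 / real (Suc n)" for n
    using less_cSUP_iff[of UNIV F "M - 1 / real (Suc n)"] F unfolding M_def by auto
  then obtain X where "\<And>n. F (X n) > M - 1 / real (Suc n)" by metis
  from cluster[rule_format, OF maximizing[OF this, unfolded M_def]] obtain j0 where j0: "j0 \<in> J" by blast
  have kB: "k j \<le> B" if j: "j \<in> J" for j
  proof -
    obtain X where "(\<lambda>n. G (X n)) \<longlonglongrightarrow> k j" using attained j by blast
    then show ?thesis using G by (intro LIMSEQ_le_const2) (auto simp: abs_le_iff)
  qed
  have bdd: "bdd_above (k ` J)" using kB by (intro bdd_aboveI) auto
  define S where "S = (SUP j\<in>J. k j)"
  have "ereal S = (SUP j\<in>J. ereal (k j))"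
  proof (rule antisym)
    show "ereal S \<le> (SUP j\<in>J. ereal (k j))"
    proof (rule ereal_le_epsilon2)
      fix e :: real assume "0 < e"
      then obtain j where j: "j \<in> J" "S - e < k j"
        using less_cSUP_iff[OF _ bdd, of "S - e"] j0 unfolding S_def by auto
      then have "ereal S \<le> ereal (k j) + ereal e" by simp
      also have "\<dots> \<le> (SUP j\<in>J. ereal (k j)) + ereal e"
        by (intro add_right_mono SUP_upper j)
      finally show "ereal S \<le> (SUP j\<in>J. ereal (k j)) + ereal e" .
    qed
    show "(SUP j\<in>J. ereal (k j)) \<le> ereal S"
      unfolding S_def by (rule SUP_least) (simp add: cSUP_upper[OF _ bdd])
  qed
  moreover have "\<exists>\<eta>>0. \<forall>x. F x > (SUP y. F y) - \<eta> \<longrightarrow> G x < S + e" if e: "0 < e" for e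
  proof (rule ccontr)
    \<comment> \<open>Failure for every \<open>\<eta> = 1 / (n + 1)\<close> yields a maximizing
      sequence along which \<open>G\<close> stays at least \<open>S + e\<close>. Its cluster value
      would exceed the supremum of all cluster values.\<close>
    assume "\<not> ?thesis"
    then have "\<not> (\<forall>x. F x > M - \<eta> \<longrightarrow> G x < S + e)" if "0 < \<eta>" for \<eta>
      using that unfolding M_def by blast
    from this[of "1 / real (Suc n)" for n]
    have "\<exists>x. F x > M - 1 / real (Suc n) \<and> G x \<ge> S + e" for n
      by (simp add: not_less)
    then obtain X where X: "\<And>n. F (X n) > M - 1 / real (Suc n)" "\<And>n. G (X n) \<ge> S + e"
      by metis
    from cluster[rule_format, OF maximizing[OF X(1), unfolded M_def]]
    obtain j and r :: "nat \<Rightarrow> nat" where j: "j \<in> J" "(\<lambda>n. G (X (r n))) \<longlonglongrightarrow> k j" by blast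
    then have "S + e \<le> k j" using X(2) by (intro LIMSEQ_le_const) auto
    also have "k j \<le> S" unfolding S_def by (rule cSUP_upper[OF j(1) bdd])
    finally show False using e by simp
  qed
  moreover have "\<exists>x. F x > (SUP y. F y) - \<eta> \<and> G x > S - e" if e: "0 < e" and \<eta>: "0 < \<eta>" for e \<eta>
  proof -
    obtain j where j: "j \<in> J" "S - e < k j"
      using less_cSUP_iff[OF _ bdd, of "S - e"] j0 e unfolding S_def by auto
    obtain X :: "nat \<Rightarrow> 'a" where "(\<lambda>n. F (X n)) \<longlonglongrightarrow> (SUP x. F x)" "(\<lambda>n. G (X n)) \<longlonglongrightarrow> k j"
      using attained j(1) by blast
    then have "\<forall>\<^sub>F n in sequentially. F (X n) > (SUP y. F y) - \<eta>" "\<forall>\<^sub>F n in sequentially. G (X n) > S - e"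
      using j(2) \<eta> by (auto elim!: order_tendstoD(1))
    then have "\<forall>\<^sub>F n in sequentially. F (X n) > (SUP y. F y) - \<eta> \<and> G (X n) > S - e"
      by (rule eventually_conj)
    from eventually_happens'[OF sequentially_bot this] show ?thesis by blast
  qed
  ultimately show ?thesis by blast
qed

section \<open>Directional limits\<close>

text \<open>The product is first countable at \<open>z\<close>: if convergence along the filter
  failed, bad points chosen in a shrinking sequence of open boxes would converge to \<open>z\<close>
  inside the quadrant and contradict the sequential limit. The filter form supplies one
  neighbourhood that works for all nearby points at once.\<close>

lemma is_vlim_imp_tendsto:
  fixes z :: "ereal ^ 'd"
  assumes f: "is_vlim v f z l"
  shows "(f \<longlongrightarrow> l) (at z within quadrant v z)"
proof (rule ccontr)
  assume "\<not> ?thesis"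
  then obtain e where "e > 0" and "\<not> (\<forall>\<^sub>F y in at z within quadrant v z. dist (f y) l < e)"
    by (auto simp: tendsto_iff)
  then have bad: "\<exists>y. y \<in> U \<and> y \<in> quadrant v z \<and> e \<le> dist (f y) l" if "open U" "z \<in> U" for U
    using that unfolding eventually_at_topological by (meson not_le)
  have "\<exists>A. \<forall>n. open (A n) \<and> z $ i \<in> A n \<and> (\<forall>S. open S \<longrightarrow> z $ i \<in> S \<longrightarrow> eventually (\<lambda>n. A n \<subseteq> S) sequentially)" for i
    by (rule countable_basis_at_decseq[of "z $ i"]) metis
  then obtain A where A: "\<And>i n :: nat. open (A i n)" "\<And>i n. z $ i \<in> A i n"
    "\<And>i S. open S \<Longrightarrow> z $ i \<in> S \<Longrightarrow> eventually (\<lambda>n. A i n \<subseteq> S) sequentially"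
    by metis
  have "\<exists>y. y \<in> {y. \<forall>i. y $ i \<in> A i n} \<and> y \<in> quadrant v z \<and> e \<le> dist (f y) l" for n
  proof (rule bad)
    show "open {y. \<forall>i. y $ i \<in> A i n}"
      unfolding open_vec_def by (auto intro!: exI[of _ "\<lambda>i. A i n"] simp: A(1))
  qed (simp add: A(2))
  then obtain y where y: "\<And>n i. y n $ i \<in> A i n" "\<And>n. y n \<in> quadrant v z"
    "\<And>n. e \<le> dist (f (y n)) l"
    unfolding mem_Collect_eq by metis
  have "y \<longlonglongrightarrow> z"
  proof (intro vec_tendstoI topological_tendstoI)
    fix i S assume "open S" "z $ i \<in> S"
    from A(3)[OF this] show "\<forall>\<^sub>F n in sequentially. y n $ i \<in> S"
      by eventually_elim (use y(1) in blast)
  qed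
  then have "(\<lambda>n. f (y n)) \<longlonglongrightarrow> l" using f y(2) by (auto simp: is_vlim_def)
  then have "\<forall>\<^sub>F n in sequentially. dist (f (y n)) l < e" using \<open>e > 0\<close> by (rule tendstoD)
  then show False using y(3) eventually_happens'[OF sequentially_bot] by (auto simp: not_less[symmetric])
qed

lemma quadrant_above_vector_nonempty: "quadrant (above_vector x) x \<noteq> {}"
proof -
  have "\<exists>y. y \<in> half_line (above_vector x $ i) (x $ i)" for i
  proof (cases "x $ i < \<infinity>")
    case True
    then have "\<infinity> \<in> half_line (above_vector x $ i) (x $ i)"
      by (simp add: above_vector_def half_line_def)
    then show ?thesis by blast
  next
    case False
    then have "0 \<in> half_line (above_vector x $ i) (x $ i)"
      by (simp add: above_vector_def half_line_def)
    then show ?thesis by blast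
  qed
  then obtain y where "\<And>i. y i \<in> half_line (above_vector x $ i) (x $ i)" by metis
  then have "(\<chi> i. y i) \<in> quadrant (above_vector x) x" by (simp add: quadrant_def)
  then show ?thesis by blast
qed

lemma is_vlim_vlim:
  assumes "skorohod_fun f" "v \<in> sign_vectors" "quadrant v x \<noteq> {}"
  shows "is_vlim v f x (vlim v f x)"
  using assms vlim_eq unfolding skorohod_fun_def by metis

text \<open>
  A sequence that stays on one side of its limit, or equals it, in each coordinate can be
  pushed into a single open quadrant, because \<open>f\<close> is continuous from above.
\<close>

lemma skorohod_fun_subseq:
  fixes X :: "nat \<Rightarrow> ereal ^ 'd"
  obtains r :: "nat \<Rightarrow> nat" and v z where "strict_mono r" "v \<in> sign_vectors" "quadrant v z \<noteq> {}"
    "\<And>f. skorohod_fun f \<Longrightarrow> (\<lambda>n. f (X (r n))) \<longlonglongrightarrow> vlim v f z"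
proof -
  obtain r z where r: "strict_mono (r :: nat \<Rightarrow> nat)" "\<And>i. (\<lambda>n. X (r n) $ i) \<longlonglongrightarrow> z $ i"
    "\<And>i. (\<forall>n. X (r n) $ i < z $ i) \<or> (\<forall>n. X (r n) $ i = z $ i) \<or> (\<forall>n. X (r n) $ i > z $ i)"
    using ereal_vec_subseq[of X] by metis
  define W where "W = (\<lambda>n. X (r n))"
  have W: "W \<longlonglongrightarrow> z" unfolding W_def by (rule vec_tendstoI) (rule r)
  \<comment> \<open>Index 0 represents all \<open>n\<close>, since each coordinate stays on one side
    of \<open>z\<close> or equals it. Where it equals \<open>z $ i\<close>, the direction is the one
    in which continuity from above allows a push.\<close>
  define v :: "int ^ 'd" where "v = (\<chi> i. if W 0 $ i < z $ i then -1
      else if W 0 $ i = z $ i then above_vector z $ i else 1)"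
  have v: "v \<in> sign_vectors" by (auto simp: v_def sign_vectors_def above_vector_def)
  \<comment> \<open>Strict inequalities with \<open>z $ i\<close> persist near \<open>W n\<close>.
    In a coordinate with \<open>W n $ i = z $ i\<close>, the vectors
    \<open>above_vector (W n)\<close> and \<open>above_vector z\<close> agree, so \<open>Y\<close>
    already lies in the right half-line.\<close>
  have near: "\<forall>\<^sub>F k in sequentially. Y k \<in> quadrant v z"
    if Y: "\<And>k. Y k \<in> quadrant (above_vector (W n)) (W n)" "Y \<longlonglongrightarrow> W n" for n Y
  proof -
    have Yi: "(\<lambda>k. Y k $ i) \<longlonglongrightarrow> W n $ i" for i
      using Y(2) by (rule tendsto_vec_nth)
    have "\<forall>\<^sub>F k in sequentially. Y k $ i \<in> half_line (v $ i) (z $ i)" for i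
    proof -
      consider "\<forall>n. W n $ i < z $ i" | "\<forall>n. W n $ i = z $ i" | "\<forall>n. W n $ i > z $ i"
        using r(3)[of i] by (auto simp: W_def)
      then show ?thesis
      proof cases
        case 1
        then have "\<forall>\<^sub>F k in sequentially. Y k $ i < z $ i"
          using order_tendstoD(2)[OF Yi] by blast
        then show ?thesis using 1 by (simp add: v_def half_line_def)
      next
        case 2
        then have "v $ i = above_vector (W n) $ i" by (simp add: v_def above_vector_def)
        then have "Y k $ i \<in> half_line (v $ i) (z $ i)" for k
          using 2[THEN spec, of n] Y(1)[of k] unfolding quadrant_def mem_Collect_eq by metis
        then show ?thesis by simp
      next
        case 3
        then have "\<forall>\<^sub>F k in sequentially. Y k $ i > z $ i"
          using order_tendstoD(1)[OF Yi] by blast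
        moreover have "v $ i = 1" using 3[THEN spec, of 0] by (auto simp: v_def)
        ultimately show ?thesis by (simp add: half_line_def)
      qed
    qed
    then show ?thesis unfolding quadrant_def by (simp add: eventually_all_finite)
  qed
  have push: "\<exists>Y. (\<forall>k. Y k \<in> quadrant (above_vector (W n)) (W n)) \<and> Y \<longlonglongrightarrow> W n" for n
    using quadrant_seq[OF quadrant_above_vector_nonempty] by blast
  have ne: "quadrant v z \<noteq> {}"
    using push[of 0] near[of _ 0] eventually_happens'[OF sequentially_bot] by blast
  have "(\<lambda>n. f (W n)) \<longlonglongrightarrow> vlim v f z" if f: "skorohod_fun f" for f
  proof (rule tendstoI)
    fix e :: real assume e: "0 < e"
    have "\<forall>\<^sub>F y in at z within quadrant v z. dist (f y) (vlim v f z) < e / 2"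
      using is_vlim_imp_tendsto[OF is_vlim_vlim[OF f v ne]] e by (intro tendstoD) simp_all
    \<comment> \<open>Hence puncturing the filter at \<open>z\<close> removes no point of the
      quadrant, and the estimate on \<open>U\<close> has no exceptional point.\<close>
    moreover have "z \<notin> quadrant v z" by (auto simp: quadrant_def half_line_def)
    ultimately obtain U where U: "open U" "z \<in> U"
      "\<And>y. y \<in> U \<Longrightarrow> y \<in> quadrant v z \<Longrightarrow> dist (f y) (vlim v f z) < e / 2"
      unfolding eventually_at_topological by metis
    have "\<forall>\<^sub>F n in sequentially. W n \<in> U" using W U(1,2) by (rule topological_tendstoD)
    then show "\<forall>\<^sub>F n in sequentially. dist (f (W n)) (vlim v f z) < e"
    proof eventually_elim
      case (elim n)
      \<comment> \<open>The value \<open>f (W n)\<close> is a limit of values inside the quadrant at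
        \<open>z\<close>. The limit turns the strict estimate into a weak one, which is why
        \<open>e / 2\<close> is used.\<close>
      obtain Y where Y: "\<And>k. Y k \<in> quadrant (above_vector (W n)) (W n)" "Y \<longlonglongrightarrow> W n"
        using push by blast
      have "is_vlim (above_vector (W n)) f (W n) (f (W n))"
        using f by (simp add: skorohod_fun_def continuous_from_above_def)
      then have fY: "(\<lambda>k. f (Y k)) \<longlonglongrightarrow> f (W n)" using Y by (auto simp: is_vlim_def)
      have "\<forall>\<^sub>F k in sequentially. Y k \<in> U" using Y(2) U(1) elim by (rule topological_tendstoD)
      with near[OF Y] have "\<forall>\<^sub>F k in sequentially. dist (f (Y k)) (vlim v f z) \<le> e / 2"
        by eventually_elim (use U(3) in \<open>auto intro: less_imp_le\<close>)
      then have "dist (f (W n)) (vlim v f z) \<le> e / 2"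
        by (intro tendsto_upperbound[OF tendsto_dist[OF fY tendsto_const]]) simp_all
      then show ?case using e by simp
    qed
  qed
  then show ?thesis using that[OF r(1) v ne] by (simp add: W_def)
qed

section \<open>Negation, absolute value and realization of directional limits\<close>

lemma skorohod_fun_uminus:
  assumes "skorohod_fun f"
  shows "skorohod_fun (\<lambda>x. - f x)"
proof -
  have "is_vlim v (\<lambda>x. - f x) x (- l)" if "is_vlim v f x l" for v x l
    using that unfolding is_vlim_def by (auto intro: tendsto_minus)
  then show ?thesis
    using assms unfolding skorohod_fun_def continuous_from_above_def by metis
qed

lemma vlim_uminus:
  assumes "skorohod_fun f" "v \<in> sign_vectors" "quadrant v x \<noteq> {}"
  shows "vlim v (\<lambda>x. - f x) x = - vlim v f x"
  using is_vlim_vlim[OF assms] unfolding is_vlim_def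
  by (intro vlim_eq) (auto simp: is_vlim_def intro: tendsto_minus)

lemma vlim_abs:
  assumes "skorohod_fun f" "v \<in> sign_vectors" "quadrant v x \<noteq> {}"
  shows "vlim v (\<lambda>x. \<bar>f x\<bar>) x = \<bar>vlim v f x\<bar>"
  using is_vlim_vlim[OF assms] unfolding is_vlim_def
  by (intro vlim_eq) (auto simp: is_vlim_def intro: tendsto_rabs)

text \<open>The sequence is chosen before the function, so \<open>f\<close> and \<open>g\<close> can
  be followed along the same points.\<close>

lemma vlim_seq:
  fixes x :: "ereal ^ 'd"
  assumes "v \<in> sign_vectors" "quadrant v x \<noteq> {}"
  obtains X where "\<And>f. skorohod_fun f \<Longrightarrow> (\<lambda>n. f (X n)) \<longlonglongrightarrow> vlim v f x"
proof -
  obtain X where "\<And>n. X n \<in> quadrant v x" "X \<longlonglongrightarrow> x" using quadrant_seq[OF assms(2)] by blast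
  then show ?thesis using that is_vlim_vlim[OF _ assms] by (metis is_vlim_def)
qed

section \<open>Derivatives of the functionals\<close>

lemma sign_vectors_nonempty: "(sign_vectors :: (int ^ 'd) set) \<noteq> {}"
proof -
  have "(\<chi> i. 1) \<in> (sign_vectors :: (int ^ 'd) set)" by (simp add: sign_vectors_def)
  then show ?thesis by blast
qed

text \<open>An empty set of maximizers contributes the bottom element of the extended reals, so
  maximum and suprema merge into one supremum over pairs. These pairs index the cluster
  values.\<close>

lemma Max_SUP_sign_vectors:
  fixes k :: "int ^ 'd \<Rightarrow> 'x \<Rightarrow> ereal"
  shows "(MAX v\<in>sign_vectors. SUP x\<in>A v. k v x) = (SUP (v, x)\<in>Sigma sign_vectors A. k v x)"
proof -
  have "(MAX v\<in>sign_vectors. SUP x\<in>A v. k v x) = (SUP v\<in>sign_vectors. SUP x\<in>A v. k v x)"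
    by (intro Max_Sup) (simp_all add: finite_sign_vectors sign_vectors_nonempty)
  also have "\<dots> = (SUP (v, x)\<in>Sigma sign_vectors A. k v x)"
    by (rule antisym) (auto intro!: SUP_least intro: SUP_upper2)
  finally show ?thesis .
qed

lemma Min_INF_sign_vectors:
  fixes k :: "int ^ 'd \<Rightarrow> 'x \<Rightarrow> ereal"
  shows "(MIN v\<in>sign_vectors. INF x\<in>A v. k v x) = - (MAX v\<in>sign_vectors. SUP x\<in>A v. - k v x)"
proof -
  have "(MIN v\<in>sign_vectors. INF x\<in>A v. k v x) = (INF v\<in>sign_vectors. INF x\<in>A v. k v x)"
    by (intro Min_Inf) (simp_all add: finite_sign_vectors sign_vectors_nonempty)
  also have "\<dots> = - (SUP v\<in>sign_vectors. SUP x\<in>A v. - k v x)"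
    by (simp add: ereal_SUP_uminus_eq)
  also have "(SUP v\<in>sign_vectors. SUP x\<in>A v. - k v x) = (MAX v\<in>sign_vectors. SUP x\<in>A v. - k v x)"
    by (intro Max_Sup[symmetric]) (simp_all add: finite_sign_vectors sign_vectors_nonempty)
  finally show ?thesis .
qed

section \<open>Pointwise and uniform estimates from the supremum norm\<close>

lemma val_add: "val (f + g) x = val f x + val g x"
  and val_diff: "val (f - g) x = val f x - val g x"
  and val_uminus: "val (- f) x = - val f x"
  and val_scaleR: "val (c *\<^sub>R f) x = c * val f x"
  by (simp_all add: val_def)

lemma abs_val_le_norm: "\<bar>val f x\<bar> \<le> norm f"
  using norm_bounded[of f "discrete x"] by (simp add: val_def)

lemma bdd_above_val: "bdd_above (range (val f))"
  using abs_val_le_norm[of f] by (intro bdd_aboveI[of _ "norm f"]) (auto simp: abs_le_iff)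

lemma val_uniform_limit:
  assumes "(\<lambda>n. norm (H n - h)) \<longlonglongrightarrow> 0" "0 < e"
  shows "\<forall>\<^sub>F n in sequentially. \<forall>x. \<bar>val (H n) x - val h x\<bar> < e"
  using order_tendstoD(2)[OF assms]
proof eventually_elim
  case (elim n)
  then show ?case using abs_val_le_norm[of "H n - h"] by (metis le_less_trans val_diff)
qed

lemma val_uniform_bound:
  assumes "(\<lambda>n. norm (H n - h)) \<longlonglongrightarrow> 0"
  obtains C where "\<And>n x. \<bar>val (H n) x\<bar> \<le> C"
proof -
  have "H \<longlonglongrightarrow> h" using assms by (simp add: LIM_zero_iff tendsto_norm_zero_iff)
  then have "Bseq H" by (intro convergent_imp_Bseq convergentI)
  then obtain C where "\<And>n. norm (H n) \<le> C" by (auto simp: Bseq_def)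
  then show ?thesis using that abs_val_le_norm order_trans by metis
qed

text \<open>One direction is fixed at a time, since the real number \<open>S\<close> is produced
  separately for each \<open>g\<close>; the derivative as a function is assembled afterwards by
  choice.\<close>

definition dir_derivative_at :: "('a linf \<Rightarrow> real) \<Rightarrow> 'a linf \<Rightarrow> 'a linf \<Rightarrow> real \<Rightarrow> bool" where
  "dir_derivative_at \<phi> f g S \<longleftrightarrow> (\<forall>t H. (\<forall>n::nat. t n > 0) \<longrightarrow> t \<longlonglongrightarrow> 0 \<longrightarrow>
     (\<lambda>n. norm (H n - g)) \<longlonglongrightarrow> 0 \<longrightarrow> (\<lambda>n. (\<phi> (f + t n *\<^sub>R H n) - \<phi> f) / t n) \<longlonglongrightarrow> S)"

lemma has_hadamard_dir_derivativeI:
  assumes "\<And>g. g \<in> D \<Longrightarrow> \<exists>S. ereal S = R g \<and> dir_derivative_at \<phi> f g S"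
  shows "\<exists>\<phi>'. has_hadamard_dir_derivative \<phi> \<phi>' f D \<and> (\<forall>g\<in>D. ereal (\<phi>' g) = R g)"
proof -
  obtain \<phi>' where \<phi>': "\<And>g. g \<in> D \<Longrightarrow> ereal (\<phi>' g) = R g \<and> dir_derivative_at \<phi> f g (\<phi>' g)"
    using assms by metis
  have "has_hadamard_dir_derivative \<phi> \<phi>' f D"
    unfolding has_hadamard_dir_derivative_def
  proof (intro ballI allI impI)
    fix h t H assume "h \<in> D" "\<forall>n::nat. t n > (0::real)" "t \<longlonglongrightarrow> 0" "(\<lambda>n. norm (H n - h)) \<longlonglongrightarrow> 0"
    with \<phi>' have "(\<lambda>n. (\<phi> (f + t n *\<^sub>R H n) - \<phi> f) / t n) \<longlonglongrightarrow> \<phi>' h"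
      unfolding dir_derivative_at_def by blast
    from tendsto_norm_zero[OF LIM_zero[OF this]]
    show "(\<lambda>n. norm ((\<phi> (f + t n *\<^sub>R H n) - \<phi> f) /\<^sub>R t n - \<phi>' h)) \<longlonglongrightarrow> 0"
      by (simp add: divide_inverse mult.commute)
  qed
  then show ?thesis using \<phi>' by blast
qed

text \<open>The pairs \<open>(v, x)\<close> with \<open>x\<close> in \<open>Mplus v (val f)\<close>
  index the cluster values: by compactness every maximizing sequence of \<open>f\<close> has a
  subsequence governed by such a pair, and approaching \<open>x\<close> inside the quadrant realizes
  each pair.\<close>

lemma sigma_derivative:
  fixes f g :: "(ereal ^ 'd) linf"
  assumes f: "f \<in> skorohod" and g: "g \<in> skorohod"
  shows "\<exists>S. ereal S = (MAX v\<in>sign_vectors. SUP x\<in>Mplus v (val f). ereal (vlim v (val g) x))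
    \<and> dir_derivative_at sigma f g S"
proof -
  have sk: "skorohod_fun (val f)" "skorohod_fun (val g)" using f g by (auto simp: skorohod_def)
  define J where "J = Sigma sign_vectors (\<lambda>v. Mplus v (val f))"
  have cluster: "\<forall>X :: nat \<Rightarrow> ereal ^ 'd. (\<lambda>n. val f (X n)) \<longlonglongrightarrow> (SUP x. val f x) \<longrightarrow>
      (\<exists>j\<in>J. \<exists>r :: nat \<Rightarrow> nat. (\<lambda>n. val g (X (r n))) \<longlonglongrightarrow> (case j of (v, x) \<Rightarrow> vlim v (val g) x))"
  proof (intro allI impI)
    fix X :: "nat \<Rightarrow> ereal ^ 'd" assume X: "(\<lambda>n. val f (X n)) \<longlonglongrightarrow> (SUP x. val f x)"
    obtain r :: "nat \<Rightarrow> nat" and v z where r: "strict_mono r" "v \<in> sign_vectors" "quadrant v z \<noteq> {}"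
      "\<And>f. skorohod_fun f \<Longrightarrow> (\<lambda>n. f (X (r n))) \<longlonglongrightarrow> vlim v f z"
      using skorohod_fun_subseq[of X] by blast
    have "(\<lambda>n. val f (X (r n))) \<longlonglongrightarrow> (SUP x. val f x)"
      using LIMSEQ_subseq_LIMSEQ[OF X r(1)] by (simp add: o_def)
    then have "(v, z) \<in> J"
      using LIMSEQ_unique[OF r(4)[OF sk(1)]] r(2,3) by (simp add: J_def Mplus_def)
    then show "\<exists>j\<in>J. \<exists>r :: nat \<Rightarrow> nat. (\<lambda>n. val g (X (r n))) \<longlonglongrightarrow> (case j of (v, x) \<Rightarrow> vlim v (val g) x)"
      using r(4)[OF sk(2)] by force
  qed
  have attained: "\<forall>j\<in>J. \<exists>X :: nat \<Rightarrow> ereal ^ 'd. (\<lambda>n. val f (X n)) \<longlonglongrightarrow> (SUP x. val f x) \<and>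
      (\<lambda>n. val g (X n)) \<longlonglongrightarrow> (case j of (v, x) \<Rightarrow> vlim v (val g) x)"
  proof
    fix j assume jJ: "j \<in> J"
    obtain v x where j: "j = (v, x)" "v \<in> sign_vectors" "quadrant v x \<noteq> {}"
      "vlim v (val f) x = (SUP x. val f x)"
      using jJ by (auto simp: J_def Mplus_def)
    obtain X where "\<And>f. skorohod_fun f \<Longrightarrow> (\<lambda>n. f (X n)) \<longlonglongrightarrow> vlim v f x"
      using vlim_seq[OF j(2,3)] by blast
    from this[OF sk(1)] this[OF sk(2)] show "\<exists>X :: nat \<Rightarrow> ereal ^ 'd. (\<lambda>n. val f (X n)) \<longlonglongrightarrow> (SUP x. val f x) \<and>
        (\<lambda>n. val g (X n)) \<longlonglongrightarrow> (case j of (v, x) \<Rightarrow> vlim v (val g) x)" using j by auto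
  qed
  obtain S where S: "ereal S = (SUP j\<in>J. ereal (case j of (v, x) \<Rightarrow> vlim v (val g) x))"
    "\<forall>e>0. \<exists>\<eta>>0. \<forall>x. val f x > (SUP y. val f y) - \<eta> \<longrightarrow> val g x < S + e"
    "\<forall>e>0. \<forall>\<eta>>0. \<exists>x. val f x > (SUP y. val f y) - \<eta> \<and> val g x > S - e"
    using sup_perturbation_cluster_values[OF bdd_above_val abs_val_le_norm cluster attained] by blast
  have "dir_derivative_at sigma f g S"
    unfolding dir_derivative_at_def
  proof (intro allI impI)
    fix t H assume t: "\<forall>n::nat. t n > (0::real)" "t \<longlonglongrightarrow> 0" and H: "(\<lambda>n. norm (H n - g)) \<longlonglongrightarrow> 0"
    obtain C where C: "\<And>n x. \<bar>val (H n) x\<bar> \<le> C" using val_uniform_bound[OF H] by blast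
    have "(\<lambda>n. ((SUP x. val f x + t n * val (H n) x) - (SUP x. val f x)) / t n) \<longlonglongrightarrow> S"
    \<comment> \<open>Convergence in norm is uniform on the whole space, so any positive threshold
      serves as \<open>\<eta>0\<close>; it is taken to be 1.\<close>
    proof (rule sup_perturbation_tendsto[OF bdd_above_val S(2,3)[rule_format] _ t(2) C zero_less_one])
      fix e :: real assume "0 < e"
      from val_uniform_limit[OF H this] show "\<forall>\<^sub>F n in sequentially.
          \<forall>x. val f x > (SUP y. val f y) - 1 \<longrightarrow> \<bar>val (H n) x - val g x\<bar> < e"
        by eventually_elim simp
    qed (use t(1) in auto)
    then show "(\<lambda>n. (sigma (f + t n *\<^sub>R H n) - sigma f) / t n) \<longlonglongrightarrow> S"
      by (simp add: sigma_def val_add val_scaleR)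
  qed
  moreover have "ereal S = (MAX v\<in>sign_vectors. SUP x\<in>Mplus v (val f). ereal (vlim v (val g) x))"
    unfolding Max_SUP_sign_vectors S(1) J_def by (simp add: case_prod_unfold)
  ultimately show ?thesis by blast
qed

text \<open>The perturbation lemmas are applied to \<bar>f\<bar> with the direction
  \<open>g * sgn f\<close>. This product need not be a Skorohod function, so its cluster values are
  computed from the limits of the two factors.\<close>

lemma delta_derivative:
  fixes f g :: "(ereal ^ 'd) linf"
  assumes f: "f \<in> skorohod" and g: "g \<in> skorohod" and nz: "f \<noteq> 0"
  shows "\<exists>S. ereal S = (MAX v\<in>sign_vectors. SUP x\<in>Mplus v (\<lambda>y. \<bar>val f y\<bar>).
      ereal (vlim v (val g) x * sgn (vlim v (val f) x)))
    \<and> dir_derivative_at delta f g S"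
proof -
  have sk: "skorohod_fun (val f)" "skorohod_fun (val g)" using f g by (auto simp: skorohod_def)
  define M where "M = (SUP x. \<bar>val f x\<bar>)"
  have M: "M > 0" using nz by (simp add: M_def norm_linf[symmetric])
  define J where "J = Sigma sign_vectors (\<lambda>v. Mplus v (\<lambda>y. \<bar>val f y\<bar>))"
  define k where "k = (\<lambda>(v, x). vlim v (val g) x * sgn (vlim v (val f) x))"
  have bdd: "bdd_above (range (\<lambda>x. \<bar>val f x\<bar>))"
    using abs_val_le_norm[of f] by (intro bdd_aboveI) auto
  have B: "\<bar>val g x * sgn (val f x)\<bar> \<le> norm g" for x
    using abs_val_le_norm[of g x] by (simp add: abs_mult sgn_if)
  have cluster: "\<forall>X :: nat \<Rightarrow> ereal ^ 'd. (\<lambda>n. \<bar>val f (X n)\<bar>) \<longlonglongrightarrow> (SUP x. \<bar>val f x\<bar>) \<longrightarrow>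
      (\<exists>j\<in>J. \<exists>r :: nat \<Rightarrow> nat. (\<lambda>n. val g (X (r n)) * sgn (val f (X (r n)))) \<longlonglongrightarrow> k j)"
  proof (intro allI impI)
    fix X :: "nat \<Rightarrow> ereal ^ 'd" assume X: "(\<lambda>n. \<bar>val f (X n)\<bar>) \<longlonglongrightarrow> (SUP x. \<bar>val f x\<bar>)"
    obtain r :: "nat \<Rightarrow> nat" and v z where r: "strict_mono r" "v \<in> sign_vectors" "quadrant v z \<noteq> {}"
      "\<And>f. skorohod_fun f \<Longrightarrow> (\<lambda>n. f (X (r n))) \<longlonglongrightarrow> vlim v f z"
      using skorohod_fun_subseq[of X] by blast
    have "(\<lambda>n. \<bar>val f (X (r n))\<bar>) \<longlonglongrightarrow> M"
      using LIMSEQ_subseq_LIMSEQ[OF X r(1)] by (simp add: o_def M_def)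
    then have vM: "\<bar>vlim v (val f) z\<bar> = M"
      using LIMSEQ_unique[OF tendsto_rabs[OF r(4)[OF sk(1)]]] by simp
    then have "(v, z) \<in> J"
      using r(2,3) vlim_abs[OF sk(1) r(2,3)] by (simp add: J_def Mplus_def M_def)
    \<comment> \<open>The limit of \<open>f\<close> has modulus \<open>M > 0\<close>, and
      \<open>sgn\<close> is continuous away from 0.\<close>
    moreover have "(\<lambda>n. val g (X (r n)) * sgn (val f (X (r n)))) \<longlonglongrightarrow> k (v, z)"
      using vM M unfolding k_def prod.case by (intro tendsto_intros r(4) sk) auto
    ultimately show "\<exists>j\<in>J. \<exists>r :: nat \<Rightarrow> nat. (\<lambda>n. val g (X (r n)) * sgn (val f (X (r n)))) \<longlonglongrightarrow> k j" by blast
  qed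
  have attained: "\<forall>j\<in>J. \<exists>X :: nat \<Rightarrow> ereal ^ 'd. (\<lambda>n. \<bar>val f (X n)\<bar>) \<longlonglongrightarrow> (SUP x. \<bar>val f x\<bar>) \<and>
      (\<lambda>n. val g (X n) * sgn (val f (X n))) \<longlonglongrightarrow> k j"
  proof
    fix j assume jJ: "j \<in> J"
    obtain v x where j: "j = (v, x)" "v \<in> sign_vectors" "quadrant v x \<noteq> {}"
      "vlim v (\<lambda>y. \<bar>val f y\<bar>) x = M"
      using jJ by (auto simp: J_def Mplus_def M_def)
    have vM: "\<bar>vlim v (val f) x\<bar> = M" using j(4) vlim_abs[OF sk(1) j(2,3)] by simp
    obtain X where X: "\<And>f. skorohod_fun f \<Longrightarrow> (\<lambda>n. f (X n)) \<longlonglongrightarrow> vlim v f x"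
      using vlim_seq[OF j(2,3)] by blast
    have "(\<lambda>n. val g (X n) * sgn (val f (X n))) \<longlonglongrightarrow> k j"
      using vM M unfolding k_def j(1) prod.case by (intro tendsto_intros X sk) auto
    moreover have "(\<lambda>n. \<bar>val f (X n)\<bar>) \<longlonglongrightarrow> M"
      using tendsto_rabs[OF X[OF sk(1)]] by (simp add: vM)
    ultimately show "\<exists>X :: nat \<Rightarrow> ereal ^ 'd. (\<lambda>n. \<bar>val f (X n)\<bar>) \<longlonglongrightarrow> (SUP x. \<bar>val f x\<bar>) \<and>
        (\<lambda>n. val g (X n) * sgn (val f (X n))) \<longlonglongrightarrow> k j"
      unfolding M_def by blast
  qed
  obtain S where S: "ereal S = (SUP j\<in>J. ereal (k j))"
    "\<forall>e>0. \<exists>\<eta>>0. \<forall>x. \<bar>val f x\<bar> > (SUP y. \<bar>val f y\<bar>) - \<eta> \<longrightarrow> val g x * sgn (val f x) < S + e"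
    "\<forall>e>0. \<forall>\<eta>>0.
      \<exists>x. \<bar>val f x\<bar> > (SUP y. \<bar>val f y\<bar>) - \<eta> \<and> val g x * sgn (val f x) > S - e"
    using sup_perturbation_cluster_values[OF bdd B cluster attained] by blast
  have "dir_derivative_at delta f g S"
    unfolding dir_derivative_at_def
  proof (intro allI impI)
    fix t H assume t: "\<forall>n::nat. t n > (0::real)" "t \<longlonglongrightarrow> 0" and H: "(\<lambda>n. norm (H n - g)) \<longlonglongrightarrow> 0"
    obtain C where C: "\<And>n x. \<bar>val (H n) x\<bar> \<le> C" using val_uniform_bound[OF H] by blast
    \<comment> \<open>\<open>K\<close> is the difference quotient of the modulus, so that
      \<open>\<bar>val f x\<bar> + t n * K n x\<close> is exactly the modulus of the perturbed
      function. It inherits the bound \<open>C\<close> from \<open>H\<close>.\<close>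
    define K where "K = (\<lambda>n x. (\<bar>val f x + t n * val (H n) x\<bar> - \<bar>val f x\<bar>) / t n)"
    have KC: "\<bar>K n x\<bar> \<le> C" for n x
    proof -
      have tn: "t n > 0" using t by simp
      have "\<bar>\<bar>val f x + t n * val (H n) x\<bar> - \<bar>val f x\<bar>\<bar> \<le> \<bar>t n * val (H n) x\<bar>" by linarith
      also have "\<dots> \<le> C * t n" using C[of n x] tn by (simp add: abs_mult mult.commute)
      finally show ?thesis using tn by (simp add: K_def pos_divide_le_eq)
    qed
    have "(\<lambda>n. t n * C) \<longlonglongrightarrow> 0 * C" by (intro tendsto_intros t)
    then have small: "\<forall>\<^sub>F n in sequentially. t n * C < M / 2"
      using M by (intro order_tendstoD(2)) auto
    \<comment> \<open>Where the modulus of \<open>f\<close> exceeds \<open>M / 2\<close>, a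
      perturbation of size below \<open>M / 2\<close> cannot change the sign of \<open>f\<close>.
      There \<open>K\<close> equals \<open>H\<close> times \<open>sgn f\<close> exactly, and uniform
      convergence of \<open>H\<close> finishes the estimate.\<close>
    have conv: "\<forall>\<^sub>F n in sequentially. \<forall>x. \<bar>val f x\<bar> > (SUP y. \<bar>val f y\<bar>) - M / 2 \<longrightarrow>
        \<bar>K n x - val g x * sgn (val f x)\<bar> < e" if e: "0 < e" for e
      using small val_uniform_limit[OF H e]
    proof eventually_elim
      case (elim n)
      have tn: "t n > 0" using t by simp
      show ?case
      proof (intro allI impI)
        fix x assume "\<bar>val f x\<bar> > (SUP y. \<bar>val f y\<bar>) - M / 2"
        then have "\<bar>val f x\<bar> > M / 2" by (simp add: M_def[symmetric])
        moreover have "\<bar>t n * val (H n) x\<bar> \<le> t n * C"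
          using C[of n x] tn by (simp add: abs_mult)
        ultimately have "\<bar>t n * val (H n) x\<bar> < \<bar>val f x\<bar>" using elim(1) by linarith
        then have "\<bar>val f x + t n * val (H n) x\<bar> - \<bar>val f x\<bar> = t n * (val (H n) x * sgn (val f x))"
          by (cases "val f x > 0") (auto simp: sgn_if)
        then have "K n x = val (H n) x * sgn (val f x)" using tn by (simp add: K_def)
        then have "\<bar>K n x - val g x * sgn (val f x)\<bar> = \<bar>val (H n) x - val g x\<bar> * \<bar>sgn (val f x)\<bar>"
          by (simp only: abs_mult[symmetric] left_diff_distrib)
        also have "\<dots> \<le> \<bar>val (H n) x - val g x\<bar>" by (simp add: sgn_if)
        also have "\<dots> < e" using elim(2) by blast
        finally show "\<bar>K n x - val g x * sgn (val f x)\<bar> < e" .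
      qed
    qed
    have "(\<lambda>n. ((SUP x. \<bar>val f x\<bar> + t n * K n x) - (SUP x. \<bar>val f x\<bar>)) / t n) \<longlonglongrightarrow> S"
      by (rule sup_perturbation_tendsto[OF bdd S(2,3)[rule_format] _ t(2) KC _ conv])
         (use t(1) M in auto)
    moreover have "\<bar>val f x\<bar> + t n * K n x = \<bar>val (f + t n *\<^sub>R H n) x\<bar>" for n x
      using t(1)[THEN spec, of n] by (simp add: K_def val_add val_scaleR)
    ultimately show "(\<lambda>n. (delta (f + t n *\<^sub>R H n) - delta f) / t n) \<longlonglongrightarrow> S"
      by (simp add: delta_def norm_linf)
  qed
  moreover have "ereal S = (MAX v\<in>sign_vectors. SUP x\<in>Mplus v (\<lambda>y. \<bar>val f y\<bar>).
      ereal (vlim v (val g) x * sgn (vlim v (val f) x)))"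
    unfolding Max_SUP_sign_vectors S(1) J_def k_def by (simp add: case_prod_unfold)
  ultimately show ?thesis by blast
qed

section \<open>The infimum and the oscillation, reduced to the supremum\<close>

lemma iota_eq_sigma: "iota f = - sigma (- f)"
  by (simp add: iota_def sigma_def val_uminus[abs_def] Inf_real_def image_image)

lemma skorohod_uminus: "f \<in> skorohod \<Longrightarrow> - f \<in> skorohod"
  using skorohod_fun_uminus by (simp add: skorohod_def val_uminus[abs_def])

text \<open>Since inf f = - sup (- f), the result for \<open>sigma\<close> is used at
  \<open>- f\<close> in direction \<open>- g\<close>. Negation turns the maximizers of
  \<open>- f\<close> into the minimizers of \<open>f\<close> and reverses the sign of directional
  limits.\<close>

lemma iota_derivative:
  fixes f g :: "(ereal ^ 'd) linf"
  assumes f: "f \<in> skorohod" and g: "g \<in> skorohod"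
  shows "\<exists>S. ereal S = (MIN v\<in>sign_vectors. INF x\<in>Mminus v (val f). ereal (vlim v (val g) x))
    \<and> dir_derivative_at iota f g S"
proof -
  have sk: "skorohod_fun (val f)" "skorohod_fun (val g)" using f g by (auto simp: skorohod_def)
  obtain S where S: "ereal S = (MAX v\<in>sign_vectors. SUP x\<in>Mplus v (val (- f)). ereal (vlim v (val (- g)) x))"
    "dir_derivative_at sigma (- f) (- g) S"
    using sigma_derivative[OF f[THEN skorohod_uminus] g[THEN skorohod_uminus]] by blast
  have neg: "(SUP y. - val f y) = - (INF y. val f y)"
    using iota_eq_sigma[of f] by (simp add: iota_def sigma_def val_uminus)
  have M: "Mplus v (val (- f)) = Mminus v (val f)" if "v \<in> sign_vectors" for v
  proof -
    have "vlim v (\<lambda>x. - val f x) x = - (INF y. val f y) \<longleftrightarrow> vlim v (val f) x = (INF y. val f y)"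
      if "quadrant v x \<noteq> {}" for x
      unfolding vlim_uminus[OF sk(1) \<open>v \<in> sign_vectors\<close> that] by (rule neg_equal_iff_equal)
    then show ?thesis
      unfolding Mplus_def Mminus_def val_uminus[abs_def] neg by blast
  qed
  \<comment> \<open>Negation passes through \<open>vlim\<close> where the limit exists; membership
    in \<open>Mminus\<close> supplies the nonempty quadrant that guarantees this.\<close>
  have L: "vlim v (val (- g)) x = - vlim v (val g) x"
    if "v \<in> sign_vectors" "x \<in> Mminus v (val f)" for v x
    using vlim_uminus[OF sk(2) that(1)] that(2) by (simp add: Mminus_def val_uminus[abs_def])
  have "(MAX v\<in>sign_vectors. SUP x\<in>Mplus v (val (- f)). ereal (vlim v (val (- g)) x))
      = (MAX v\<in>sign_vectors. SUP x\<in>Mminus v (val f). - ereal (vlim v (val g) x))"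
    by (intro arg_cong[where f = Max] image_cong SUP_cong refl) (simp_all add: M L)
  then have "ereal S = (MAX v\<in>sign_vectors. SUP x\<in>Mminus v (val f). - ereal (vlim v (val g) x))"
    by (rule trans[OF S(1)])
  then have "- ereal S = (MIN v\<in>sign_vectors. INF x\<in>Mminus v (val f). ereal (vlim v (val g) x))"
    unfolding Min_INF_sign_vectors by (rule arg_cong[where f = uminus])
  then have "ereal (- S) = (MIN v\<in>sign_vectors. INF x\<in>Mminus v (val f). ereal (vlim v (val g) x))"
    by (simp only: uminus_ereal.simps(1))
  moreover have "dir_derivative_at iota f g (- S)"
    unfolding dir_derivative_at_def
  proof (intro allI impI)
    fix t H assume t: "\<forall>n::nat. t n > (0::real)" "t \<longlonglongrightarrow> 0" and H: "(\<lambda>n. norm (H n - g)) \<longlonglongrightarrow> 0"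
    have "norm (- H n - - g) = norm (H n - g)" for n
      using norm_minus_commute[of g "H n"] by simp
    with H have "(\<lambda>n. norm (- H n - - g)) \<longlonglongrightarrow> 0" by simp
    then have "(\<lambda>n. (sigma (- f + t n *\<^sub>R (- H n)) - sigma (- f)) / t n) \<longlonglongrightarrow> S"
      using S(2)[unfolded dir_derivative_at_def, THEN spec[of _ t], THEN spec[of _ "\<lambda>n. - H n"]] t
      by (simp only: simp_thms)
    moreover have "(iota (f + t n *\<^sub>R H n) - iota f) / t n
        = - ((sigma (- f + t n *\<^sub>R (- H n)) - sigma (- f)) / t n)" for n
      unfolding iota_eq_sigma minus_divide_left by simp
    ultimately show "(\<lambda>n. (iota (f + t n *\<^sub>R H n) - iota f) / t n) \<longlonglongrightarrow> - S"
      by (simp only: tendsto_minus)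
  qed
  ultimately show ?thesis by blast
qed

text \<open>Both derivatives are real numbers, so the extended-real difference never meets
  \<infinity> - \<infinity>, and difference quotients subtract termwise.\<close>

lemma alpha_derivative:
  fixes f g :: "(ereal ^ 'd) linf"
  assumes f: "f \<in> skorohod" and g: "g \<in> skorohod"
  shows "\<exists>S. ereal S = (MAX v\<in>sign_vectors. SUP x\<in>Mplus v (val f). ereal (vlim v (val g) x))
      - (MIN v\<in>sign_vectors. INF x\<in>Mminus v (val f). ereal (vlim v (val g) x))
    \<and> dir_derivative_at alpha f g S"
proof -
  obtain S where S: "ereal S = (MAX v\<in>sign_vectors. SUP x\<in>Mplus v (val f). ereal (vlim v (val g) x))"
    "dir_derivative_at sigma f g S"
    using sigma_derivative[OF f g] by blast
  obtain I where I: "ereal I = (MIN v\<in>sign_vectors. INF x\<in>Mminus v (val f). ereal (vlim v (val g) x))"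
    "dir_derivative_at iota f g I"
    using iota_derivative[OF f g] by blast
  have alpha: "alpha h = sigma h - iota h" for h :: "(ereal ^ 'd) linf"
    by (simp add: alpha_def sigma_def iota_def)
  have "dir_derivative_at alpha f g (S - I)"
    unfolding dir_derivative_at_def
  proof (intro allI impI)
    fix t H assume "\<forall>n::nat. t n > (0::real)" "t \<longlonglongrightarrow> 0" "(\<lambda>n. norm (H n - g)) \<longlonglongrightarrow> 0"
    then have "(\<lambda>n. (sigma (f + t n *\<^sub>R H n) - sigma f) / t n - (iota (f + t n *\<^sub>R H n) - iota f) / t n) \<longlonglongrightarrow> S - I"
      using S(2) I(2) unfolding dir_derivative_at_def by (intro tendsto_diff) blast+
    then show "(\<lambda>n. (alpha (f + t n *\<^sub>R H n) - alpha f) / t n) \<longlonglongrightarrow> S - I"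
      by (simp add: alpha diff_divide_distrib[symmetric] algebra_simps)
  qed
  then show ?thesis by (intro exI[of _ "S - I"]) (simp add: S(1)[symmetric] I(1)[symmetric])
qed

theorem corollary2p7:
  fixes f :: "(ereal ^ 'd) linf"
  assumes "f \<in> skorohod" and "f \<noteq> 0"
  shows
    "(\<exists>\<delta>'. has_hadamard_dir_derivative delta \<delta>' f skorohod \<and>
        (\<forall>g\<in>skorohod. ereal (\<delta>' g) =
           (MAX v\<in>sign_vectors. SUP x\<in>Mplus v (\<lambda>y. \<bar>val f y\<bar>).
              ereal (vlim v (val g) x * sgn (vlim v (val f) x)))))
     \<and> (\<exists>\<sigma>'. has_hadamard_dir_derivative sigma \<sigma>' f skorohod \<and>
        (\<forall>g\<in>skorohod. ereal (\<sigma>' g) =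
           (MAX v\<in>sign_vectors. SUP x\<in>Mplus v (val f). ereal (vlim v (val g) x))))
     \<and> (\<exists>\<iota>'. has_hadamard_dir_derivative iota \<iota>' f skorohod \<and>
        (\<forall>g\<in>skorohod. ereal (\<iota>' g) =
           (MIN v\<in>sign_vectors. INF x\<in>Mminus v (val f). ereal (vlim v (val g) x))))
     \<and> (\<exists>\<alpha>'. has_hadamard_dir_derivative alpha \<alpha>' f skorohod \<and>
        (\<forall>g\<in>skorohod. ereal (\<alpha>' g) =
           (MAX v\<in>sign_vectors. SUP x\<in>Mplus v (val f). ereal (vlim v (val g) x))
           - (MIN v\<in>sign_vectors. INF x\<in>Mminus v (val f). ereal (vlim v (val g) x))))"
  by (intro conjI has_hadamard_dir_derivativeI sigma_derivative delta_derivative iota_derivative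
      alpha_derivative assms)

end
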